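(* Let $P_1,\ldots,P_r$ be $d$-dimensional polytopes in $\mathbb{R}^d$ that are relatively in general position, and let $P=P_1+\cdots+P_r$ be their Minkowski sum. Then for all real numbers $a$, $$\sum_{k=0}^{d-1}(-1)^k (k+a)\, f^\delta_k(P) = a(1-r)\bigl(1 - (-1)^d\bigr).$$
   Context: For a polytope $Q$, $f_k(Q)$ denotes the number of $k$-dimensional faces of $Q$ (including $Q$ itself). Every nonempty face $F$ of a Minkowski sum $P=P_1+\cdots+P_r$ can be written uniquely as $F=F_1+\cdots+F_r$ with $F_i$ a nonempty face of $P_i$; this is called the decomposition of $F$. The decomposition is exact if $\dim(F)=\dim(F_1)+\cdots+\dim(F_r)$. The polytopes $P_1,\ldots,P_r$ are relatively in general position if every facet of $P_1+\cdots+P_r$ has an exact decomposition. For a nonempty face $F$ of $P$ with decomposition $F=F_1+\cdots+F_r$, set $f^\delta_k(F)=f_k(F)-(f_k(F_1)+\cdots+f_k(F_r))$. In particular $f^\delta_k(P)=f_k(P)-(f_k(P_1)+\cdots+f_k(P_r))$. *)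

theory Defs
  imports "HOL-Analysis.Analysis"
begin

definition f_num :: "nat \<Rightarrow> 'a::euclidean_space set \<Rightarrow> nat" where
  "f_num k Q = card {F. F face_of Q \<and> aff_dim F = int k}"

text \<open>Sums of sets are Minkowski sums (theory \<^verbatim>\<open>HOL-Library.Set_Algebras\<close>).
  For polytopes and a nonempty face \<open>F\<close> of their sum, the family \<open>G\<close> below exists
  and is unique on \<open>{1..r}\<close>; its values outside \<open>{1..r}\<close> are irrelevant.\<close>

definition face_decomposition ::
    "nat \<Rightarrow> (nat \<Rightarrow> 'a::euclidean_space set) \<Rightarrow> 'a set \<Rightarrow> (nat \<Rightarrow> 'a set) \<Rightarrow> bool" where
  "face_decomposition r P F G \<longleftrightarrow>
     (\<forall>i\<in>{1..r}. G i face_of P i \<and> G i \<noteq> {}) \<and> F = (\<Sum>i\<in>{1..r}. G i)"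

definition has_exact_decomposition ::
    "nat \<Rightarrow> (nat \<Rightarrow> 'a::euclidean_space set) \<Rightarrow> 'a set \<Rightarrow> bool" where
  "has_exact_decomposition r P F \<longleftrightarrow>
     (\<exists>G. face_decomposition r P F G \<and> aff_dim F = (\<Sum>i\<in>{1..r}. aff_dim (G i)))"

definition relatively_in_general_position ::
    "nat \<Rightarrow> (nat \<Rightarrow> 'a::euclidean_space set) \<Rightarrow> bool" where
  "relatively_in_general_position r P \<longleftrightarrow>
     (\<forall>F. F facet_of (\<Sum>i\<in>{1..r}. P i) \<longrightarrow> has_exact_decomposition r P F)"

text \<open>A face is the sum of its decomposition, so \<open>f\<^sup>\<delta>\<^sub>k\<close> takes the decomposition \<open>G\<close> of the
  face as its argument. The decomposition of \<open>P\<^sub>1 + \<dots> + P\<^sub>r\<close> as a face of itself is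
  \<open>P\<^sub>1, \<dots>, P\<^sub>r\<close>.\<close>

definition f_delta :: "nat \<Rightarrow> nat \<Rightarrow> (nat \<Rightarrow> 'a::euclidean_space set) \<Rightarrow> int" where
  "f_delta k r G = int (f_num k (\<Sum>i\<in>{1..r}. G i)) - (\<Sum>i\<in>{1..r}. int (f_num k (G i)))"

lemma face_decomposition_self:
  assumes "\<And>i. i \<in> {1..r} \<Longrightarrow> convex (P i) \<and> P i \<noteq> {}"
  shows "face_decomposition r P (\<Sum>i\<in>{1..r}. P i) P"
  using assms by (auto simp: face_decomposition_def intro: face_of_refl)

end

theory Submission
  imports Defs
begin

text \<open>Write \<open>d\<close> for the dimension of the space. The weight \<open>k + a\<close> splits the claim into two. The part
  with the constant \<open>a\<close> is Euler's relation, applied to the sum \<open>P\<close> and to each of the \<open>r\<close> summands.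
  The part with the weight \<open>k\<close> says that the sum of \<open>(-1)\<^bsup>dim G\<^esup> dim G\<close> over the proper nonempty
  faces \<open>G\<close> of \<open>P\<close> is the total of the same sums for the summands.

  For the latter, a facet has an exact decomposition by hypothesis, and exactness is inherited by
  faces: it says that the direction spaces of the summands form a direct sum, and this passes to
  subspaces. Hence \<open>dim G = dim G\<^sub>1 + \<dots> + dim G\<^sub>r\<close> for every proper nonempty face \<open>G\<close> of \<open>P\<close>
  (\<open>aff_dim_max_face_general_position\<close>). After exchanging sums, it remains to show, for each proper
  nonempty face \<open>F\<close> of \<open>P\<^sub>i\<close>, that the signs \<open>(-1)\<^bsup>dim G\<^esup>\<close> of the faces \<open>G\<close> of \<open>P\<close> with \<open>G\<^sub>i = F\<close>
  add up to \<open>(-1)\<^bsup>dim F\<^esup>\<close>.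

  This is a statement about normal fans. The linear functionals that are maximal over \<open>P\<close> exactly
  on \<open>G\<close> form a relatively open convex cone of dimension \<open>d - dim G\<close>. A functional determines its face
  of \<open>P\<close>, which in turn determines its face of \<open>P\<^sub>i\<close>, so the cones of the faces \<open>G\<close> with \<open>G\<^sub>i = F\<close>
  partition the cone of \<open>F\<close> (\<open>euler_sign_fan_refines\<close>). For such partitions the sign
  \<open>(-1)\<^bsup>dim\<^esup>\<close> is additive, because on relatively open convex sets it is the compactly supported
  Euler characteristic; the proof refines the partition by the cells of a hyperplane arrangement
  (\<open>euler_sign_partition\<close>). With the one-point polytope in place of \<open>P\<^sub>i\<close> the same
  argument yields Euler's relation (\<open>euler_relation\<close>).\<close>


section \<open>The Euler characteristic of relatively open convex sets\<close>

text \<open>On relatively open convex sets this is the Euler characteristic with compact supports, an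
  additive invariant; on faces of polytopes it serves as the sign in alternating sums. The value
  \<open>0\<close> at the empty set lets empty pieces of a partition be included in sums.\<close>

definition euler_sign :: "'a::euclidean_space set \<Rightarrow> real" where
  "euler_sign X = (if X = {} then 0 else (-1) ^ nat (aff_dim X))"

lemma euler_sign_empty [simp]: "euler_sign {} = 0"
  by (simp add: euler_sign_def)

lemma rel_open_affine_Int_open:
  fixes A :: "'a::euclidean_space set"
  assumes "affine A" "open U"
  shows "rel_open (A \<inter> U)"
proof (cases "A \<inter> U = {}")
  case True
  then show ?thesis by (simp add: rel_open)
next
  case False
  then have "affine hull (A \<inter> U) = A"
    using affine_hull_affine_Int_open[OF assms] assms(1) by (simp add: affine_hull_eq)
  then show ?thesis
    using assms by (auto simp: rel_open openin_open)
qed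

lemma rel_open_eq_affine_Int_open:
  fixes X :: "'a::euclidean_space set"
  assumes "rel_open X"
  obtains U where "open U" "X = affine hull X \<inter> U"
  using assms by (auto simp: rel_open openin_open)

lemma rel_open_Int_open:
  fixes X :: "'a::euclidean_space set"
  assumes "rel_open X" "open V"
  shows "rel_open (X \<inter> V)"
proof -
  obtain U where U: "open U" "X = affine hull X \<inter> U"
    using rel_open_eq_affine_Int_open[OF assms(1)] .
  have "rel_open (affine hull X \<inter> (U \<inter> V))"
    using U assms by (intro rel_open_affine_Int_open) auto
  then show ?thesis using U by (simp add: Int_assoc[symmetric])
qed

definition sign_part :: "'a::euclidean_space set \<Rightarrow> 'a \<Rightarrow> real \<Rightarrow> 'a set" where
  "sign_part X h s = {c \<in> X. sgn (h \<bullet> c) = s}"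

lemma sign_part_eq_Int:
  "sign_part X h 1 = X \<inter> {c. h \<bullet> c > 0}"
  "sign_part X h (-1) = X \<inter> {c. h \<bullet> c < 0}"
  "sign_part X h 0 = X \<inter> {c. h \<bullet> c = 0}"
  by (auto simp: sign_part_def sgn_if split: if_splits)

lemma sign_part_zero:
  fixes X :: "'a::euclidean_space set"
  assumes "rel_open X"
  obtains U where "open U" "sign_part X h 0 = (affine hull X \<inter> {c. h \<bullet> c = 0}) \<inter> U"
proof -
  obtain U where "open U" "X = affine hull X \<inter> U"
    using rel_open_eq_affine_Int_open[OF assms] .
  then show ?thesis using that unfolding sign_part_eq_Int by blast
qed

lemma
  fixes X :: "'a::euclidean_space set"
  assumes "convex X" "rel_open X" "s \<in> {-1,0,1}"
  shows convex_sign_part: "convex (sign_part X h s)"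
    and rel_open_sign_part: "rel_open (sign_part X h s)"
proof -
  show "convex (sign_part X h s)"
    using assms by (auto simp: sign_part_eq_Int convex_halfspace_gt convex_halfspace_lt
        convex_hyperplane intro!: convex_Int)
  obtain U where U: "open U" "sign_part X h 0 = (affine hull X \<inter> {c. h \<bullet> c = 0}) \<inter> U"
    using sign_part_zero[OF assms(2)] .
  have "rel_open (sign_part X h 0)"
    unfolding U(2) by (intro rel_open_affine_Int_open affine_Int affine_affine_hull
        affine_hyperplane U)
  then show "rel_open (sign_part X h s)"
    using assms(2,3)
    by (auto simp: sign_part_eq_Int open_halfspace_gt open_halfspace_lt intro!: rel_open_Int_open)
qed

lemma sign_part_zero_nonempty:
  assumes "convex X" "p \<in> X" "q \<in> X" "h \<bullet> p < 0" "h \<bullet> q > 0"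
  shows "sign_part X h 0 \<noteq> {}"
proof -
  have "connected ((\<lambda>x. h \<bullet> x) ` X)"
    using assms(1) by (intro connected_continuous_image convex_connected continuous_intros)
  then have "0 \<in> (\<lambda>x. h \<bullet> x) ` X"
    using assms by (auto simp: connected_iff_interval dest!: bspec)
  then show ?thesis by (auto simp: sign_part_eq_Int)
qed

text \<open>A relatively open set that contains \<open>p\<close> and \<open>q\<close> contains points slightly beyond \<open>p\<close> on the line
  from \<open>q\<close>; so if the hyperplane passes through \<open>p\<close> but not through \<open>q\<close>, the set has points
  strictly on both sides.\<close>

lemma rel_open_opposite_sign:
  fixes X :: "'a::euclidean_space set"
  assumes "rel_open X" "p \<in> X" "q \<in> X" "h \<bullet> p = 0"
  obtains e where "e > 0" "p + e *\<^sub>R (p - q) \<in> X" "h \<bullet> (p + e *\<^sub>R (p - q)) = - (e * (h \<bullet> q))"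
proof -
  obtain U where U: "open U" "X = affine hull X \<inter> U"
    using rel_open_eq_affine_Int_open[OF assms(1)] .
  obtain d where d: "d > 0" "ball p d \<subseteq> U"
    using U assms(2) open_contains_ball by blast
  \<comment> \<open>the added \<open>1\<close> covers the case \<open>p = q\<close>\<close>
  define e where "e = d / (2 * (norm (p - q) + 1))"
  have e: "e > 0" using d by (simp add: e_def add_nonneg_pos)
  have n: "norm (p - q) + 1 > 0" by (simp add: add_nonneg_pos)
  have "e * norm (p - q) \<le> e * (norm (p - q) + 1)" using e by simp
  also have "\<dots> = d / 2" using n by (simp add: e_def field_simps)
  also have "\<dots> < d" using d by simp
  finally have "p + e *\<^sub>R (p - q) \<in> ball p d"
    using e by (simp add: dist_norm norm_minus_commute)
  moreover have "(1 + e) *\<^sub>R p + (- e) *\<^sub>R q \<in> affine hull X"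
    using assms by (intro mem_affine) (auto simp: hull_inc)
  moreover have "(1 + e) *\<^sub>R p + (- e) *\<^sub>R q = p + e *\<^sub>R (p - q)"
    by (simp add: algebra_simps)
  ultimately have "p + e *\<^sub>R (p - q) \<in> X" using U d by auto
  with that e show ?thesis by (simp add: inner_add_right inner_diff_right assms(4))
qed

text \<open>A hyperplane that properly cuts a relatively open convex set of dimension \<open>n\<close> leaves two
  pieces of dimension \<open>n\<close> and one of dimension \<open>n - 1\<close>, and
  \<open>2 (-1)\<^sup>n + (-1)\<^bsup>n-1\<^esup> = (-1)\<^sup>n\<close>. Otherwise the set is itself one of the three
  pieces and the others are empty.\<close>

lemma euler_sign_split:
  fixes X :: "'a::euclidean_space set"
  assumes "convex X" "rel_open X"
  shows "(\<Sum>s\<in>{-1,0,1}. euler_sign (sign_part X h s)) = euler_sign X"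
proof (cases "\<exists>s. \<forall>c\<in>X. sgn (h \<bullet> c) = s")
  case True
  then obtain s where s: "\<forall>c\<in>X. sgn (h \<bullet> c) = s" by blast
  show ?thesis
  proof (cases "X = {}")
    case True
    then show ?thesis by (simp add: sign_part_def)
  next
    case False
    then have s3: "s \<in> {-1,0,1}" using s by (auto simp: sgn_if split: if_splits)
    have "sign_part X h t = (if t = s then X else {})" for t
      using s by (auto simp: sign_part_def)
    then have "(\<Sum>t\<in>{-1,0,1}. euler_sign (sign_part X h t))
        = (\<Sum>t\<in>{-1,0,1}. if t = s then euler_sign X else 0)"
      by (intro sum.cong) auto
    also have "\<dots> = euler_sign X" using s3 by (subst sum.delta) auto
    finally show ?thesis .
  qed
next
  case False
  then have "\<exists>c\<in>X. \<exists>c'\<in>X. sgn (h \<bullet> c) \<noteq> sgn (h \<bullet> c')" by metis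
  then obtain c c' where c: "c \<in> X" "c' \<in> X" "sgn (h \<bullet> c) \<noteq> sgn (h \<bullet> c')" by blast
  have "sign_part X h 0 \<noteq> {}"
  proof (rule ccontr)
    assume z: "\<not> sign_part X h 0 \<noteq> {}"
    then have "h \<bullet> c \<noteq> 0" "h \<bullet> c' \<noteq> 0" using c by (auto simp: sign_part_eq_Int)
    then have "h \<bullet> c < 0 \<and> 0 < h \<bullet> c' \<or> h \<bullet> c' < 0 \<and> 0 < h \<bullet> c"
      using c(3) by (auto simp: sgn_if split: if_splits)
    then show False
      using sign_part_zero_nonempty[OF assms(1)] c z by blast
  qed
  then obtain p where p: "p \<in> X" "h \<bullet> p = 0" by (auto simp: sign_part_eq_Int)
  have "h \<bullet> c \<noteq> 0 \<or> h \<bullet> c' \<noteq> 0" using c(3) by auto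
  then obtain q where q: "q \<in> X" "h \<bullet> q \<noteq> 0"
    using c by blast
  obtain e where e: "e > 0" "p + e *\<^sub>R (p - q) \<in> X"
      "h \<bullet> (p + e *\<^sub>R (p - q)) = - (e * (h \<bullet> q))"
    using rel_open_opposite_sign[OF assms(2) p(1) q(1) p(2)] .
  have "\<exists>a\<in>X. h \<bullet> a < 0" "\<exists>a\<in>X. h \<bullet> a > 0"
    using q e by (cases "h \<bullet> q > 0"; force simp: mult_less_0_iff zero_less_mult_iff)+
  then have ne: "X \<inter> {c. h \<bullet> c > 0} \<noteq> {}" "X \<inter> {c. h \<bullet> c < 0} \<noteq> {}" by auto
  have dims: "aff_dim (sign_part X h 1) = aff_dim X" "aff_dim (sign_part X h (-1)) = aff_dim X"
    unfolding sign_part_eq_Int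
    using ne assms by (auto simp: open_halfspace_gt open_halfspace_lt intro!: aff_dim_convex_Int_open)
  obtain U where U: "open U" "sign_part X h 0 = (affine hull X \<inter> {c. h \<bullet> c = 0}) \<inter> U"
    using sign_part_zero[OF assms(2)] .
  have "aff_dim (sign_part X h 0) = aff_dim (affine hull X \<inter> {c. h \<bullet> c = 0})"
    using \<open>sign_part X h 0 \<noteq> {}\<close> unfolding U(2)
    by (intro aff_dim_convex_Int_open U affine_imp_convex affine_Int affine_hyperplane) auto
  also have "\<dots> = aff_dim X - 1"
  proof -
    have "p \<in> affine hull X \<inter> {c. h \<bullet> c = 0}" "q \<in> affine hull X"
      using p q by (auto simp: hull_inc)
    then show ?thesis
      using q(2) aff_dim_affine_Int_hyperplane[OF affine_affine_hull, of X h 0] by auto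
  qed
  finally have d0: "aff_dim (sign_part X h 0) = aff_dim X - 1" .
  moreover have "aff_dim (sign_part X h 0) \<ge> 0"
    using \<open>sign_part X h 0 \<noteq> {}\<close>
    by (metis aff_dim_negative_iff not_le)
  ultimately have "nat (aff_dim X) = Suc (nat (aff_dim (sign_part X h 0)))" by linarith
  then show ?thesis
    using dims ne \<open>sign_part X h 0 \<noteq> {}\<close> p(1)
    by (auto simp: euler_sign_def sign_part_eq_Int)
qed

definition sign_cell :: "'a::euclidean_space set \<Rightarrow> 'a set \<Rightarrow> 'a \<Rightarrow> 'a set" where
  "sign_cell H X c = {c' \<in> X. \<forall>h\<in>H. sgn (h \<bullet> c') = sgn (h \<bullet> c)}"

definition sign_cells :: "'a::euclidean_space set \<Rightarrow> 'a set \<Rightarrow> 'a set set" where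
  "sign_cells H X = sign_cell H X ` X"

lemma sign_cells_subset: "A \<in> sign_cells H X \<Longrightarrow> A \<subseteq> X"
  by (auto simp: sign_cells_def sign_cell_def)

lemma sign_cells_nonempty: "A \<in> sign_cells H X \<Longrightarrow> A \<noteq> {}"
  by (auto simp: sign_cells_def sign_cell_def)

lemma sign_cells_disjoint:
  "X \<inter> Y = {} \<Longrightarrow> sign_cells H X \<inter> sign_cells H Y = {}"
  using sign_cells_subset sign_cells_nonempty by (metis Int_emptyI le_inf_iff subset_empty)

text \<open>The recursion over the hyperplanes: cutting by one more of them first splits the set into three
  parts, whose cells with respect to the remaining hyperplanes are then collected.\<close>

lemma sign_cells_insert:
  "sign_cells (insert h H) X = (\<Union>s\<in>{-1,0,1}. sign_cells H (sign_part X h s))"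
proof -
  have cell: "sign_cell (insert h H) X c = sign_cell H (sign_part X h (sgn (h \<bullet> c))) c" for c
    by (auto simp: sign_cell_def sign_part_def)
  show ?thesis
  proof (intro equalityI subsetI)
    fix A assume "A \<in> sign_cells (insert h H) X"
    then obtain c where c: "c \<in> X" "A = sign_cell H (sign_part X h (sgn (h \<bullet> c))) c"
      by (auto simp: sign_cells_def cell)
    moreover have "sgn (h \<bullet> c) \<in> {-1,0,1}" by (auto simp: sgn_if)
    moreover have "c \<in> sign_part X h (sgn (h \<bullet> c))" using c by (simp add: sign_part_def)
    ultimately show "A \<in> (\<Union>s\<in>{-1,0,1}. sign_cells H (sign_part X h s))"
      unfolding sign_cells_def by blast
  next
    fix A assume "A \<in> (\<Union>s\<in>{-1,0,1}. sign_cells H (sign_part X h s))"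
    then obtain s c where "c \<in> sign_part X h s" "A = sign_cell H (sign_part X h s) c"
      by (auto simp: sign_cells_def)
    then have "c \<in> X" "A = sign_cell (insert h H) X c"
      by (auto simp: cell sign_part_def)
    then show "A \<in> sign_cells (insert h H) X" by (auto simp: sign_cells_def)
  qed
qed

lemma sign_part_disjoint: "s \<noteq> t \<Longrightarrow> sign_part X h s \<inter> sign_part X h t = {}"
  by (auto simp: sign_part_def)

lemma finite_sign_cells: "finite H \<Longrightarrow> finite (sign_cells H X)"
proof (induction H arbitrary: X rule: finite_induct)
  case empty
  have "sign_cells {} X \<subseteq> {X}" by (auto simp: sign_cells_def sign_cell_def)
  then show ?case by (rule finite_subset) simp
next
  case (insert h H)
  then show ?case by (simp add: sign_cells_insert)
qed

lemma sum_euler_sign_cells: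
  fixes X :: "'a::euclidean_space set"
  assumes "finite H" "convex X" "rel_open X"
  shows "(\<Sum>A\<in>sign_cells H X. euler_sign A) = euler_sign X"
  using assms
proof (induction H arbitrary: X rule: finite_induct)
  case empty
  have "sign_cells {} X = (if X = {} then {} else {X})"
    by (auto simp: sign_cells_def sign_cell_def)
  then show ?case by simp
next
  case (insert h H)
  have "(\<Sum>A\<in>sign_cells (insert h H) X. euler_sign A)
      = (\<Sum>s\<in>{-1,0,1}. \<Sum>A\<in>sign_cells H (sign_part X h s). euler_sign A)"
    unfolding sign_cells_insert
    by (intro sum.UNION_disjoint) (auto simp: finite_sign_cells insert.hyps
        simp del: insert_iff intro!: sign_cells_disjoint sign_part_disjoint)
  also have "\<dots> = (\<Sum>s\<in>{-1,0,1}. euler_sign (sign_part X h s))"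
    using insert.prems
    by (intro sum.cong refl insert.IH convex_sign_part rel_open_sign_part)
  also have "\<dots> = euler_sign X" by (rule euler_sign_split[OF insert.prems])
  finally show ?case .
qed

text \<open>These are the unions of cells of the central hyperplane arrangement with normal vectors \<open>H\<close>.\<close>

definition sign_saturated :: "'a::euclidean_space set \<Rightarrow> 'a set \<Rightarrow> bool" where
  "sign_saturated H X \<longleftrightarrow> (\<forall>c\<in>X. \<forall>c'. (\<forall>h\<in>H. sgn (h \<bullet> c') = sgn (h \<bullet> c)) \<longrightarrow> c' \<in> X)"

text \<open>A cell of the union that meets a saturated piece lies inside this piece.\<close>

lemma sign_cells_Union:
  assumes "\<And>Y. Y \<in> \<D> \<Longrightarrow> sign_saturated H Y"
  shows "sign_cells H (\<Union>\<D>) = (\<Union>Y\<in>\<D>. sign_cells H Y)"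
proof -
  have "sign_cell H (\<Union>\<D>) c = sign_cell H Y c" if "Y \<in> \<D>" "c \<in> Y" for Y c
  proof -
    have "\<forall>c'. (\<forall>h\<in>H. sgn (h \<bullet> c') = sgn (h \<bullet> c)) \<longrightarrow> c' \<in> Y"
      using assms[OF that(1)] that(2) by (simp add: sign_saturated_def)
    then show ?thesis using that by (auto simp: sign_cell_def)
  qed
  then show ?thesis by (force simp: sign_cells_def)
qed

text \<open>Additivity for partitions that need not come from hyperplanes themselves, as the cones of a
  normal fan do not: the pieces are refined by a common arrangement, and on both sides the
  sum over the cells replaces the sign of the set.\<close>

lemma euler_sign_partition:
  fixes X :: "'a::euclidean_space set"
  assumes "finite H" "finite \<D>" "disjoint \<D>" "\<Union>\<D> = X" "convex X" "rel_open X"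
    and \<D>: "\<And>Y. Y \<in> \<D> \<Longrightarrow> convex Y \<and> rel_open Y \<and> sign_saturated H Y"
  shows "(\<Sum>Y\<in>\<D>. euler_sign Y) = euler_sign X"
proof -
  have "(\<Sum>Y\<in>\<D>. euler_sign Y) = (\<Sum>Y\<in>\<D>. \<Sum>A\<in>sign_cells H Y. euler_sign A)"
    using \<D> assms(1) by (intro sum.cong refl) (simp add: sum_euler_sign_cells)
  also have "\<dots> = (\<Sum>A\<in>(\<Union>Y\<in>\<D>. sign_cells H Y). euler_sign A)"
    using assms(1-3)
    by (intro sum.UNION_disjoint[symmetric])
      (auto simp: finite_sign_cells intro!: sign_cells_disjoint dest: disjointD)
  also have "(\<Union>Y\<in>\<D>. sign_cells H Y) = sign_cells H X"
    using sign_cells_Union[of \<D> H] \<D> assms(4) by simp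
  also have "(\<Sum>A\<in>sign_cells H X. euler_sign A) = euler_sign X"
    using assms by (intro sum_euler_sign_cells)
  finally show ?thesis .
qed


section \<open>Faces and normal cones of polytopes\<close>

definition max_face :: "'a::euclidean_space set \<Rightarrow> 'a \<Rightarrow> 'a set" where
  "max_face S c = {x \<in> S. \<forall>y\<in>S. c \<bullet> y \<le> c \<bullet> x}"

lemma max_face_eq_Int:
  assumes "x \<in> max_face S c"
  shows "max_face S c = S \<inter> {y. c \<bullet> y = c \<bullet> x}"
  using assms by (auto simp: max_face_def intro: order.antisym)

lemma max_face_zero [simp]: "max_face S 0 = S"
  by (simp add: max_face_def)

lemma max_face_face_of:
  assumes "convex S"
  shows "max_face S c face_of S"
proof (cases "max_face S c = {}")
  case False
  then obtain x where x: "x \<in> max_face S c" by blast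
  then have "\<And>y. y \<in> S \<Longrightarrow> c \<bullet> y \<le> c \<bullet> x" by (simp add: max_face_def)
  then show ?thesis
    unfolding max_face_eq_Int[OF x] by (intro face_of_Int_supporting_hyperplane_le assms)
qed simp

lemma max_face_nonempty:
  assumes "compact S" "S \<noteq> {}"
  shows "max_face S c \<noteq> {}"
proof -
  have "continuous_on S (\<lambda>x. c \<bullet> x)" by (intro continuous_intros)
  from continuous_attains_sup[OF assms this] show ?thesis by (auto simp: max_face_def)
qed

text \<open>A face of the hull of \<open>V\<close> is the hull of points of \<open>V\<close>. In this form the face selected by
  \<open>c\<close> depends only on how \<open>c\<close> orders the finite set \<open>V\<close>.\<close>

lemma max_face_convex_hull:
  fixes V :: "'a::euclidean_space set"
  assumes "finite V"
  shows "max_face (convex hull V) c = convex hull (max_face V c)"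
proof
  obtain V' where V': "V' \<subseteq> V" "max_face (convex hull V) c = convex hull V'"
    using face_of_convex_hull_subset[OF finite_imp_compact[OF assms] max_face_face_of]
      convex_convex_hull by metis
  have "V' \<subseteq> max_face (convex hull V) c" unfolding V'(2) by (rule hull_subset)
  then have "V' \<subseteq> max_face V c"
    using V'(1) by (auto simp: max_face_def hull_inc)
  then show "max_face (convex hull V) c \<subseteq> convex hull (max_face V c)"
    unfolding V'(2) by (rule hull_mono)
next
  have "max_face V c \<subseteq> max_face (convex hull V) c"
  proof
    fix x assume x: "x \<in> max_face V c"
    then have "convex hull V \<subseteq> {y. c \<bullet> y \<le> c \<bullet> x}"
      by (intro hull_minimal convex_halfspace_le) (auto simp: max_face_def)
    with x show "x \<in> max_face (convex hull V) c" by (auto simp: max_face_def hull_inc)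
  qed
  then show "convex hull (max_face V c) \<subseteq> max_face (convex hull V) c"
    by (intro hull_minimal face_of_imp_convex[OF max_face_face_of] convex_convex_hull)
qed

lemma face_of_polytope_eq_max_face:
  fixes S :: "'a::euclidean_space set"
  assumes "polytope S" "F face_of S" "F \<noteq> {}"
  obtains c where "F = max_face S c"
proof -
  have "F exposed_face_of S"
    using assms by (simp add: exposed_face_of_polyhedron polytope_imp_polyhedron)
  then obtain c b where c: "S \<subseteq> {x. c \<bullet> x \<le> b}" "F = S \<inter> {x. c \<bullet> x = b}"
    by (auto simp: exposed_face_of_def)
  with assms(3) have "F = max_face S c"
    by (auto simp: max_face_def subset_iff intro: order.antisym)
  then show ?thesis by (rule that)
qed

text \<open>For a nonempty face \<open>F\<close> of a polytope this is the relative interior of the usual normal cone;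
  being the fibres of the map \<open>c \<mapsto> max_face S c\<close>, these sets partition the space.\<close>

definition normal_cone_of_face :: "'a::euclidean_space set \<Rightarrow> 'a set \<Rightarrow> 'a set" where
  "normal_cone_of_face S F = {c. max_face S c = F}"

text \<open>A functional is maximal exactly on \<open>F\<close> if and only if it is constant on \<open>F\<close> and strictly smaller at
  the remaining points of \<open>V\<close>. So the cone is the intersection of a linear subspace with an open
  polyhedral set, from which convexity, relative openness and dimension can be read off.\<close>

lemma normal_cone_of_face_eq:
  fixes V F :: "'a::euclidean_space set"
  assumes V: "finite V" and F: "F face_of convex hull V" and f: "f \<in> F"
  shows "normal_cone_of_face (convex hull V) F =
    {c. \<forall>x\<in>span ((\<lambda>x. x - f) ` F). orthogonal x c} \<inter> (\<Inter>v\<in>V - F. {c. c \<bullet> v < c \<bullet> f})"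
proof (intro equalityI subsetI)
  fix c assume "c \<in> normal_cone_of_face (convex hull V) F"
  then have c: "max_face (convex hull V) c = F" by (simp add: normal_cone_of_face_def)
  have "orthogonal c y" if "y \<in> (\<lambda>x. x - f) ` F" for y
    using that max_face_eq_Int[of f "convex hull V" c] f c
    by (auto simp: orthogonal_def inner_diff_right)
  then have "orthogonal c x" if "x \<in> span ((\<lambda>x. x - f) ` F)" for x
    using that by (rule orthogonal_to_span[rotated])
  moreover have "c \<bullet> v < c \<bullet> f" if "v \<in> V - F" for v
  proof -
    have "v \<in> convex hull V" using that by (simp add: hull_inc)
    moreover have "f \<in> max_face (convex hull V) c" using c f by simp
    moreover have "v \<notin> max_face (convex hull V) c" using c that by simp
    ultimately show ?thesis
      using max_face_eq_Int[of f "convex hull V" c] by (fastforce simp: max_face_def)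
  qed
  ultimately show "c \<in> {c. \<forall>x\<in>span ((\<lambda>x. x - f) ` F). orthogonal x c} \<inter>
      (\<Inter>v\<in>V - F. {c. c \<bullet> v < c \<bullet> f})"
    by (auto simp: orthogonal_commute)
next
  fix c assume c: "c \<in> {c. \<forall>x\<in>span ((\<lambda>x. x - f) ` F). orthogonal x c} \<inter>
      (\<Inter>v\<in>V - F. {c. c \<bullet> v < c \<bullet> f})"
  then have lt: "c \<bullet> v < c \<bullet> f" if "v \<in> V" "v \<notin> F" for v using that by simp
  have eq: "c \<bullet> x = c \<bullet> f" if "x \<in> F" for x
  proof -
    have "x - f \<in> span ((\<lambda>x. x - f) ` F)" using that by (intro span_base) auto
    then have "orthogonal (x - f) c" using c by blast
    then show ?thesis by (simp add: orthogonal_def inner_diff_left inner_commute[of c])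
  qed
  have sub: "F \<subseteq> convex hull V" using F by (rule face_of_imp_subset)
  have "c \<bullet> v \<le> c \<bullet> f" if "v \<in> V" for v
  proof (cases "v \<in> F")
    case False
    with lt[of v] that show ?thesis by simp
  qed (simp add: eq)
  then have "V \<subseteq> {y. c \<bullet> y \<le> c \<bullet> f}" by blast
  then have le: "convex hull V \<subseteq> {y. c \<bullet> y \<le> c \<bullet> f}"
    by (intro hull_minimal convex_halfspace_le)
  have "F \<subseteq> max_face (convex hull V) c"
    using le sub eq by (auto simp: max_face_def)
  moreover have "max_face (convex hull V) c \<subseteq> F"
  proof -
    have "f \<in> max_face (convex hull V) c" using \<open>F \<subseteq> max_face (convex hull V) c\<close> f by blast
    have "max_face V c \<subseteq> F"
    proof
      fix v assume v: "v \<in> max_face V c"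
      then have "v \<in> max_face (convex hull V) c"
        unfolding max_face_convex_hull[OF V] by (rule hull_inc)
      then have "c \<bullet> v = c \<bullet> f"
        using max_face_eq_Int[OF \<open>f \<in> max_face (convex hull V) c\<close>] by blast
      moreover have "v \<in> V" using v by (simp add: max_face_def)
      ultimately show "v \<in> F" using lt[of v] by force
    qed
    then show ?thesis unfolding max_face_convex_hull[OF V]
      by (intro hull_minimal face_of_imp_convex[OF F])
  qed
  ultimately show "c \<in> normal_cone_of_face (convex hull V) F"
    by (simp add: normal_cone_of_face_def)
qed

lemma
  fixes S F :: "'a::euclidean_space set"
  assumes "polytope S" "F face_of S" "F \<noteq> {}"
  shows convex_normal_cone: "convex (normal_cone_of_face S F)"
    and rel_open_normal_cone: "rel_open (normal_cone_of_face S F)"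
    and normal_cone_nonempty: "normal_cone_of_face S F \<noteq> {}"
    and aff_dim_normal_cone: "aff_dim (normal_cone_of_face S F) = int DIM('a) - aff_dim F"
proof -
  obtain V where V: "finite V" "S = convex hull V" using assms(1) by (auto simp: polytope_def)
  obtain f where f: "f \<in> F" using assms(3) by blast
  define L where "L = span ((\<lambda>x. x - f) ` F)"
  define A where "A = {c. \<forall>x\<in>L. orthogonal x c}"
  define U where "U = (\<Inter>v\<in>V - F. {c. c \<bullet> v < c \<bullet> f})"
  have N: "normal_cone_of_face S F = A \<inter> U"
    using normal_cone_of_face_eq[OF V(1), of F f] assms(2) f V(2) by (simp add: A_def U_def L_def)
  have A: "subspace A"
    by (auto simp: A_def subspace_def orthogonal_def inner_add_right)
  have half: "{c. c \<bullet> v < c \<bullet> f} = {c. (v - f) \<bullet> c < 0}" for v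
    by (auto simp: inner_diff_left inner_commute[of v] inner_commute[of f])
  have U: "open U" "convex U"
    unfolding U_def half using V(1)
    by (auto intro!: open_INT convex_INT open_halfspace_lt convex_halfspace_lt)
  show "convex (normal_cone_of_face S F)"
    unfolding N using A U by (simp add: convex_Int subspace_imp_convex)
  show "rel_open (normal_cone_of_face S F)"
    unfolding N using A U by (intro rel_open_affine_Int_open subspace_imp_affine)
  show ne: "normal_cone_of_face S F \<noteq> {}"
    using face_of_polytope_eq_max_face[OF assms] by (auto simp: normal_cone_of_face_def)
  have "aff_dim (A \<inter> U) = aff_dim A"
    using ne N A U by (intro aff_dim_convex_Int_open subspace_imp_convex) auto
  also have "\<dots> = int (dim A)" using A by (rule aff_dim_subspace)
  also have "dim A + dim L = DIM('a)"
    using dim_subspace_orthogonal_to_vectors[of L UNIV] by (simp add: A_def L_def)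
  then have "int (dim A) = int DIM('a) - int (dim L)" by simp
  also have "int (dim L) = aff_dim F"
    using aff_dim_eq_dim_subtract[of f F] f by (simp add: L_def hull_inc)
  finally show "aff_dim (normal_cone_of_face S F) = int DIM('a) - aff_dim F" by (simp add: N)
qed

text \<open>The signs of \<open>c\<close> at the differences \<open>v - w\<close> record how \<open>c\<close> orders \<open>V\<close>, hence determine the
  maximal face.\<close>

lemma sign_saturated_normal_cone:
  fixes V :: "'a::euclidean_space set"
  assumes "finite V" "(\<lambda>(v, w). v - w) ` (V \<times> V) \<subseteq> H"
  shows "sign_saturated H (normal_cone_of_face (convex hull V) F)"
proof -
  have eq: "max_face V c' = max_face V c" if "\<forall>h\<in>H. sgn (h \<bullet> c') = sgn (h \<bullet> c)" for c c'
  proof -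
    have "c' \<bullet> w \<le> c' \<bullet> v \<longleftrightarrow> c \<bullet> w \<le> c \<bullet> v" if "v \<in> V" "w \<in> V" for v w
    proof -
      have "v - w \<in> H" using assms(2) that by auto
      then have "sgn ((v - w) \<bullet> c') = sgn ((v - w) \<bullet> c)"
        using \<open>\<forall>h\<in>H. sgn (h \<bullet> c') = sgn (h \<bullet> c)\<close> by blast
      then have "0 \<le> (v - w) \<bullet> c' \<longleftrightarrow> 0 \<le> (v - w) \<bullet> c"
        by (metis zero_le_sgn_iff)
      then show ?thesis
        by (simp add: inner_diff_left inner_commute[of c] inner_commute[of c'])
    qed
    then show ?thesis by (auto simp: max_face_def)
  qed
  show ?thesis
    unfolding sign_saturated_def normal_cone_of_face_def max_face_convex_hull[OF assms(1)]
  proof (intro ballI allI impI)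
    fix c c' assume c: "c \<in> {c. convex hull max_face V c = F}"
      and s: "\<forall>h\<in>H. sgn (h \<bullet> c') = sgn (h \<bullet> c)"
    from s have "max_face V c' = max_face V c" by (rule eq)
    with c show "c' \<in> {c. convex hull max_face V c = F}" by simp
  qed
qed

lemma euler_sign_normal_cone:
  fixes S F :: "'a::euclidean_space set"
  assumes "polytope S" "F face_of S" "F \<noteq> {}"
  shows "euler_sign (normal_cone_of_face S F) = (-1) ^ DIM('a) * euler_sign F"
proof -
  have "aff_dim F \<ge> 0" using assms(3) by (metis aff_dim_negative_iff not_le)
  moreover have "aff_dim F \<le> int DIM('a)" by (rule aff_dim_le_DIM)
  ultimately have "DIM('a) = nat (int DIM('a) - aff_dim F) + nat (aff_dim F)" by linarith
  then have "(-1::real) ^ DIM('a) =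
      (-1) ^ nat (int DIM('a) - aff_dim F) * (-1) ^ nat (aff_dim F)"
    by (metis power_add)
  then have "(-1::real) ^ DIM('a) * (-1) ^ nat (aff_dim F) = (-1) ^ nat (int DIM('a) - aff_dim F)"
    by (simp add: mult.assoc flip: power_mult_distrib)
  then show ?thesis
    using assms normal_cone_nonempty[OF assms] aff_dim_normal_cone[OF assms]
    by (simp add: euler_sign_def)
qed

text \<open>The normal fan of \<open>P\<close> refines that of \<open>S\<close>.\<close>

definition fan_refines :: "'a::euclidean_space set \<Rightarrow> 'a set \<Rightarrow> bool" where
  "fan_refines P S \<longleftrightarrow> (\<forall>c c'. max_face P c = max_face P c' \<longrightarrow> max_face S c = max_face S c')"

text \<open>The normal cones of the faces in the sum partition the normal cone of \<open>F\<close>; additivity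
  of \<open>euler_sign\<close> gives the claim up to the factor \<open>(-1)\<^sup>d\<close> that
  comes from passing between the dimension of a face and that of its normal cone.\<close>

lemma euler_sign_fan_refines:
  fixes P S F :: "'a::euclidean_space set"
  assumes P: "polytope P" "P \<noteq> {}" and S: "polytope S" and ref: "fan_refines P S"
    and F: "F face_of S" "F \<noteq> {}"
  shows "(\<Sum>G\<in>max_face P ` normal_cone_of_face S F. euler_sign G) = euler_sign F"
proof -
  define \<G> where "\<G> = max_face P ` normal_cone_of_face S F"
  obtain V where V: "finite V" "P = convex hull V" using P by (auto simp: polytope_def)
  define H where "H = (\<lambda>(v, w). v - w) ` (V \<times> V)"
  have face: "G face_of P \<and> G \<noteq> {}" if "G \<in> \<G>" for G
    using that max_face_face_of[OF polytope_imp_convex[OF P(1)]]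
      max_face_nonempty[OF polytope_imp_compact[OF P(1)] P(2)]
    by (auto simp: \<G>_def)
  have "finite \<G>"
    using face by (intro finite_subset[OF _ finite_polytope_faces[OF P(1)]]) auto
  have inj: "inj_on (normal_cone_of_face P) \<G>"
    by (auto simp: inj_on_def \<G>_def normal_cone_of_face_def)
  have "disjoint (normal_cone_of_face P ` \<G>)"
    by (auto simp: disjoint_def normal_cone_of_face_def)
  moreover have "\<Union> (normal_cone_of_face P ` \<G>) = normal_cone_of_face S F"
  proof (intro equalityI subsetI)
    fix c assume "c \<in> \<Union> (normal_cone_of_face P ` \<G>)"
    then obtain c' where "max_face S c' = F" "max_face P c = max_face P c'"
      by (auto simp: \<G>_def normal_cone_of_face_def)
    then have "max_face S c = F" using ref unfolding fan_refines_def by metis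
    then show "c \<in> normal_cone_of_face S F" by (simp add: normal_cone_of_face_def)
  next
    fix c assume "c \<in> normal_cone_of_face S F"
    then have "max_face P c \<in> \<G>" by (simp add: \<G>_def)
    moreover have "c \<in> normal_cone_of_face P (max_face P c)"
      by (simp add: normal_cone_of_face_def)
    ultimately show "c \<in> \<Union> (normal_cone_of_face P ` \<G>)" by blast
  qed
  ultimately have "(\<Sum>Y\<in>normal_cone_of_face P ` \<G>. euler_sign Y) =
      euler_sign (normal_cone_of_face S F)"
  proof (intro euler_sign_partition[of H])
    show "finite H" "finite (normal_cone_of_face P ` \<G>)"
      using V(1) \<open>finite \<G>\<close> by (auto simp: H_def)
    show "convex (normal_cone_of_face S F)" "rel_open (normal_cone_of_face S F)"
      using convex_normal_cone[OF S F] rel_open_normal_cone[OF S F] .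
    show "convex Y \<and> rel_open Y \<and> sign_saturated H Y"
      if Y: "Y \<in> normal_cone_of_face P ` \<G>" for Y
    proof -
      obtain G where G: "G \<in> \<G>" "Y = normal_cone_of_face P G" using Y by blast
      then have "sign_saturated H Y"
        unfolding G V(2) by (intro sign_saturated_normal_cone V) (simp add: H_def)
      then show ?thesis
        using G face convex_normal_cone[OF P(1)] rel_open_normal_cone[OF P(1)] by blast
    qed
  qed
  then have "(\<Sum>G\<in>\<G>. (-1) ^ DIM('a) * euler_sign G) = (-1) ^ DIM('a) * euler_sign F"
    using face by (simp add: sum.reindex[OF inj] euler_sign_normal_cone[OF P(1)]
        euler_sign_normal_cone[OF S F])
  then show ?thesis by (simp add: \<G>_def flip: sum_distrib_left)
qed

lemma faces_eq_max_face_image: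
  fixes S :: "'a::euclidean_space set"
  assumes "polytope S" "S \<noteq> {}"
  shows "{F. F face_of S \<and> F \<noteq> {}} = range (max_face S)"
proof -
  have "max_face S c face_of S \<and> max_face S c \<noteq> {}" for c
    using assms max_face_face_of max_face_nonempty polytope_imp_compact polytope_imp_convex
    by metis
  moreover have "F \<in> range (max_face S)" if "F face_of S" "F \<noteq> {}" for F
    using face_of_polytope_eq_max_face[OF assms(1) that] by blast
  ultimately show ?thesis by blast
qed

text \<open>Every fan refines the normal fan of a point, whose only cone is the whole space.\<close>

lemma euler_relation:
  fixes P :: "'a::euclidean_space set"
  assumes "polytope P" "P \<noteq> {}"
  shows "(\<Sum>G | G face_of P \<and> G \<noteq> {}. euler_sign G) = 1"
proof -
  have "normal_cone_of_face {0} {0} = (UNIV :: 'a set)"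
    by (auto simp: normal_cone_of_face_def max_face_def)
  moreover have "fan_refines P {0}" by (auto simp: fan_refines_def max_face_def)
  moreover have "polytope {0::'a}" by (rule polytope_sing)
  ultimately have "(\<Sum>G\<in>range (max_face P). euler_sign G) = euler_sign {0::'a}"
    using euler_sign_fan_refines[OF assms, of "{0}" "{0}"] by (simp add: face_of_refl)
  then show ?thesis
    by (simp add: faces_eq_max_face_image[OF assms]) (simp add: euler_sign_def)
qed


section \<open>Faces of Minkowski sums\<close>

lemma sum_mem_set_sum:
  assumes "finite I" "\<And>i. i \<in> I \<Longrightarrow> s i \<in> P i"
  shows "(\<Sum>i\<in>I. s i) \<in> (\<Sum>i\<in>I. P i)"
  using assms by (auto simp: set_sum_alt)

lemma set_sum_memE:
  assumes "finite I" "x \<in> (\<Sum>i\<in>I. P i)"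
  obtains s where "x = (\<Sum>i\<in>I. s i)" "\<And>i. i \<in> I \<Longrightarrow> s i \<in> P i"
  using assms by (auto simp: set_sum_alt)

lemma set_sum_nonempty:
  assumes "finite I" "\<And>i. i \<in> I \<Longrightarrow> A i \<noteq> {}"
  shows "(\<Sum>i\<in>I. A i) \<noteq> {}"
  using assms by (induction I rule: finite_induct) (auto simp: set_plus_def)

lemma polytope_set_plus:
  fixes A B :: "'a::euclidean_space set"
  assumes "polytope A" "polytope B"
  shows "polytope (A + B)"
proof -
  obtain V where V: "finite V" "A = convex hull V"
    using assms(1) by (auto simp: polytope_def)
  obtain W where W: "finite W" "B = convex hull W"
    using assms(2) by (auto simp: polytope_def)
  have "A + B = convex hull (V + W)" by (simp only: V W convex_hull_set_plus)
  moreover have "finite (V + W)" using V(1) W(1) by (rule finite_set_plus)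
  ultimately show ?thesis unfolding polytope_def by blast
qed

lemma polytope_set_sum:
  fixes P :: "'i \<Rightarrow> 'a::euclidean_space set"
  assumes "finite I" "\<And>i. i \<in> I \<Longrightarrow> polytope (P i)"
  shows "polytope (\<Sum>i\<in>I. P i)"
  using assms
proof (induction I rule: finite_induct)
  case empty
  have "polytope {0::'a}" by (rule polytope_sing)
  then show ?case by (simp add: set_zero)
next
  case (insert i I)
  then show ?case by (simp add: polytope_set_plus)
qed

text \<open>A sum of points maximises \<open>c\<close> over the Minkowski sum exactly if each term maximises \<open>c\<close> over
  its summand, since replacing a single term by a better one would improve the sum.\<close>

lemma sum_mem_max_face_iff:
  fixes P :: "'i \<Rightarrow> 'a::euclidean_space set"
  assumes I: "finite I" and s: "\<forall>i\<in>I. s i \<in> P i"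
  shows "(\<Sum>i\<in>I. s i) \<in> max_face (\<Sum>i\<in>I. P i) c \<longleftrightarrow> (\<forall>i\<in>I. s i \<in> max_face (P i) c)"
proof
  assume m: "(\<Sum>i\<in>I. s i) \<in> max_face (\<Sum>i\<in>I. P i) c"
  have "c \<bullet> y \<le> c \<bullet> s i" if i: "i \<in> I" and y: "y \<in> P i" for i y
  proof -
    have split: "(\<Sum>j\<in>I. f j) = f i + (\<Sum>j\<in>I - {i}. f j)" for f :: "'i \<Rightarrow> 'a"
      using I i by (rule sum.remove)
    \<comment> \<open>the competitor in which only the term at \<open>i\<close> is changed\<close>
    have "(\<Sum>j\<in>I. (s(i := y)) j) \<in> (\<Sum>j\<in>I. P j)"
      using I s y by (intro sum_mem_set_sum) auto
    then have "c \<bullet> (\<Sum>j\<in>I. (s(i := y)) j) \<le> c \<bullet> (\<Sum>j\<in>I. s j)"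
      using m by (simp add: max_face_def)
    moreover have "(\<Sum>j\<in>I. (s(i := y)) j) = y + (\<Sum>j\<in>I - {i}. s j)"
      unfolding split by simp
    ultimately show ?thesis unfolding split[of s] by (simp add: inner_add_right)
  qed
  then show "\<forall>i\<in>I. s i \<in> max_face (P i) c" using s by (simp add: max_face_def)
next
  assume m: "\<forall>i\<in>I. s i \<in> max_face (P i) c"
  have "c \<bullet> y \<le> c \<bullet> (\<Sum>i\<in>I. s i)" if y: "y \<in> (\<Sum>i\<in>I. P i)" for y
  proof -
    obtain t where t: "y = (\<Sum>i\<in>I. t i)" "\<And>i. i \<in> I \<Longrightarrow> t i \<in> P i"
      using set_sum_memE[OF I y] by blast
    then show ?thesis using m
      by (auto simp: inner_sum_right max_face_def intro!: sum_mono)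
  qed
  then show "(\<Sum>i\<in>I. s i) \<in> max_face (\<Sum>i\<in>I. P i) c"
    using sum_mem_set_sum[OF I, of s P] s by (simp add: max_face_def)
qed

lemma max_face_set_sum:
  fixes P :: "'i \<Rightarrow> 'a::euclidean_space set"
  assumes I: "finite I"
  shows "max_face (\<Sum>i\<in>I. P i) c = (\<Sum>i\<in>I. max_face (P i) c)"
proof (intro equalityI subsetI)
  fix x assume x: "x \<in> max_face (\<Sum>i\<in>I. P i) c"
  then have "x \<in> (\<Sum>i\<in>I. P i)" by (simp add: max_face_def)
  then obtain s where s: "x = (\<Sum>i\<in>I. s i)" "\<And>i. i \<in> I \<Longrightarrow> s i \<in> P i"
    using set_sum_memE[OF I] by blast
  then have "\<forall>i\<in>I. s i \<in> max_face (P i) c"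
    using x sum_mem_max_face_iff[OF I, of s P c] by simp
  then show "x \<in> (\<Sum>i\<in>I. max_face (P i) c)"
    unfolding s(1) by (intro sum_mem_set_sum I) blast
next
  fix x assume "x \<in> (\<Sum>i\<in>I. max_face (P i) c)"
  then obtain s where s: "x = (\<Sum>i\<in>I. s i)" "\<And>i. i \<in> I \<Longrightarrow> s i \<in> max_face (P i) c"
    using set_sum_memE[OF I] by blast
  moreover have "s i \<in> P i" if "i \<in> I" for i
    using s(2)[OF that] by (simp add: max_face_def)
  ultimately show "x \<in> max_face (\<Sum>i\<in>I. P i) c"
    using sum_mem_max_face_iff[OF I, of s P c] by simp
qed

text \<open>An element of the face of \<open>P i\<close> can be completed by maximising points of the other summands
  to a point of the face of the sum.\<close>

lemma max_face_summand_mono: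
  fixes P :: "'i \<Rightarrow> 'a::euclidean_space set"
  assumes I: "finite I" "i \<in> I" and P: "\<And>j. j \<in> I \<Longrightarrow> compact (P j) \<and> P j \<noteq> {}"
    and sub: "max_face (\<Sum>j\<in>I. P j) c \<subseteq> max_face (\<Sum>j\<in>I. P j) c'"
  shows "max_face (P i) c \<subseteq> max_face (P i) c'"
proof
  fix x assume x: "x \<in> max_face (P i) c"
  have "\<forall>j\<in>I. \<exists>y. y \<in> max_face (P j) c" using P max_face_nonempty by blast
  then obtain s where s: "\<And>j. j \<in> I \<Longrightarrow> s j \<in> max_face (P j) c" by metis
  let ?t = "s(i := x)"
  have t: "\<forall>j\<in>I. ?t j \<in> max_face (P j) c" using s x by simp
  then have tP: "\<forall>j\<in>I. ?t j \<in> P j" by (simp add: max_face_def)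
  have "(\<Sum>j\<in>I. ?t j) \<in> max_face (\<Sum>j\<in>I. P j) c"
    using sum_mem_max_face_iff[OF I(1) tP] t by blast
  then have "(\<Sum>j\<in>I. ?t j) \<in> max_face (\<Sum>j\<in>I. P j) c'" using sub by blast
  then have "?t i \<in> max_face (P i) c'"
    using sum_mem_max_face_iff[OF I(1) tP] I(2) by blast
  then show "x \<in> max_face (P i) c'" by simp
qed

lemma fan_refines_summand:
  fixes P :: "'i \<Rightarrow> 'a::euclidean_space set"
  assumes "finite I" "i \<in> I" "\<And>j. j \<in> I \<Longrightarrow> compact (P j) \<and> P j \<noteq> {}"
  shows "fan_refines (\<Sum>j\<in>I. P j) (P i)"
  unfolding fan_refines_def
proof (intro allI impI)
  fix c c' assume eq: "max_face (\<Sum>j\<in>I. P j) c = max_face (\<Sum>j\<in>I. P j) c'"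
  show "max_face (P i) c = max_face (P i) c'"
  proof
    show "max_face (P i) c \<subseteq> max_face (P i) c'"
      by (rule max_face_summand_mono[OF assms]) (simp_all add: eq)
    show "max_face (P i) c' \<subseteq> max_face (P i) c"
      by (rule max_face_summand_mono[OF assms]) (simp_all add: eq)
  qed
qed

text \<open>If a point \<open>m\<close> of \<open>B i\<close> were outside \<open>A i\<close>, a functional separating it from \<open>A i\<close> would have a larger
  maximum over \<open>B i\<close> than over \<open>A i\<close>. As maxima over Minkowski sums add and \<open>A j \<subseteq> B j\<close> for all \<open>j\<close>,
  the two sums would differ.\<close>

lemma set_sum_cancel:
  fixes A B :: "'i \<Rightarrow> 'a::euclidean_space set"
  assumes I: "finite I" "i \<in> I"
    and A: "\<And>j. j \<in> I \<Longrightarrow> compact (A j) \<and> convex (A j) \<and> A j \<subseteq> B j"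
    and B: "\<And>j. j \<in> I \<Longrightarrow> compact (B j) \<and> B j \<noteq> {}"
    and eq: "(\<Sum>j\<in>I. A j) = (\<Sum>j\<in>I. B j)"
  shows "A i = B i"
proof (rule ccontr)
  assume "A i \<noteq> B i"
  then obtain m where m: "m \<in> B i" "m \<notin> A i" using A I by blast
  obtain a b where ab: "a \<bullet> m < b" "\<forall>x\<in>A i. b < a \<bullet> x"
    using separating_hyperplane_closed_point[of "A i" m] A[OF I(2)] m(2) compact_imp_closed
    by blast
  \<comment> \<open>the separating functional is smaller at \<open>m\<close>, so maximise its negative\<close>
  have "\<forall>j\<in>I. \<exists>y. y \<in> max_face (B j) (- a)" using B max_face_nonempty by blast
  then obtain t where t: "\<And>j. j \<in> I \<Longrightarrow> t j \<in> max_face (B j) (- a)" by metis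
  then have tB: "\<forall>j\<in>I. t j \<in> B j" by (simp add: max_face_def)
  have top: "(\<Sum>j\<in>I. t j) \<in> max_face (\<Sum>j\<in>I. B j) (- a)"
    using sum_mem_max_face_iff[OF I(1) tB] t by blast
  have "(\<Sum>j\<in>I. t j) \<in> (\<Sum>j\<in>I. A j)" unfolding eq using tB by (intro sum_mem_set_sum I(1)) blast
  then obtain s where s: "(\<Sum>j\<in>I. t j) = (\<Sum>j\<in>I. s j)" "\<And>j. j \<in> I \<Longrightarrow> s j \<in> A j"
    using set_sum_memE[OF I(1)] by blast
  then have "\<forall>j\<in>I. s j \<in> B j" using A by blast
  from sum_mem_max_face_iff[OF I(1) this, of "- a"] have "s i \<in> max_face (B i) (- a)"
    using top I(2) unfolding s(1) by blast
  then have "(- a) \<bullet> m \<le> (- a) \<bullet> s i" using m(1) by (simp add: max_face_def)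
  moreover have "b < a \<bullet> s i" using ab(2) s(2) I(2) by blast
  ultimately show False using ab(1) by simp
qed

text \<open>General position only provides some exact decomposition of a facet; by uniqueness it is the one
  into the maximal faces of the summands.\<close>

lemma decomposition_unique:
  fixes P :: "'i \<Rightarrow> 'a::euclidean_space set"
  assumes I: "finite I" "i \<in> I"
    and P: "\<And>j. j \<in> I \<Longrightarrow> compact (P j) \<and> convex (P j) \<and> P j \<noteq> {}"
    and D: "\<And>j. j \<in> I \<Longrightarrow> D j face_of P j \<and> D j \<noteq> {}"
    and eq: "max_face (\<Sum>j\<in>I. P j) c = (\<Sum>j\<in>I. D j)"
  shows "D i = max_face (P i) c"
proof -
  have DP: "D j \<subseteq> P j" if "j \<in> I" for j using D[OF that] face_of_imp_subset by blast
  have sub: "D j \<subseteq> max_face (P j) c" if j: "j \<in> I" for j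
  proof
    fix x assume x: "x \<in> D j"
    have "\<forall>k\<in>I. \<exists>y. y \<in> D k" using D by blast
    then obtain s where s: "\<And>k. k \<in> I \<Longrightarrow> s k \<in> D k" by metis
    let ?t = "s(j := x)"
    have t: "\<And>k. k \<in> I \<Longrightarrow> ?t k \<in> D k" using s x by simp
    have tP: "\<forall>k\<in>I. ?t k \<in> P k" using t DP by blast
    have "(\<Sum>k\<in>I. ?t k) \<in> max_face (\<Sum>k\<in>I. P k) c"
      unfolding eq using t by (rule sum_mem_set_sum[OF I(1)])
    then have "?t j \<in> max_face (P j) c"
      using sum_mem_max_face_iff[OF I(1) tP] j by blast
    then show "x \<in> max_face (P j) c" by simp
  qed
  show ?thesis
  proof (rule set_sum_cancel[OF I])
    fix j assume j: "j \<in> I"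
    have "compact (D j)" "convex (D j)"
      using D[OF j] P[OF j] face_of_imp_compact face_of_imp_convex by blast+
    then show "compact (D j) \<and> convex (D j) \<and> D j \<subseteq> max_face (P j) c"
      using sub[OF j] by blast
    have "max_face (P j) c face_of P j" using P[OF j] max_face_face_of by blast
    then show "compact (max_face (P j) c) \<and> max_face (P j) c \<noteq> {}"
      using P[OF j] face_of_imp_compact max_face_nonempty by blast
  next
    show "(\<Sum>j\<in>I. D j) = (\<Sum>j\<in>I. max_face (P j) c)"
      using eq max_face_set_sum[OF I(1)] by metis
  qed
qed

section \<open>Exact decompositions\<close>

text \<open>The direction space of \<open>A + B\<close> is the sum of those of \<open>A\<close> and \<open>B\<close>, so dimensions add exactly
  if these meet only in \<open>0\<close>.\<close>

lemma aff_dim_set_plus: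
  fixes A B :: "'a::euclidean_space set"
  assumes a: "a \<in> A" and b: "b \<in> B"
  shows "aff_dim (A + B) =
    aff_dim A + aff_dim B - int (dim (span ((\<lambda>x. x - a) ` A) \<inter> span ((\<lambda>x. x - b) ` B)))"
proof -
  define A0 B0 where "A0 = (\<lambda>x. x - a) ` A" and "B0 = (\<lambda>x. x - b) ` B"
  have 0: "0 \<in> A0" "0 \<in> B0" using a b by (auto simp: A0_def B0_def image_iff)
  have "(\<lambda>x. x - (a + b)) ` (A + B) = A0 + B0"
    by (force simp: A0_def B0_def set_plus_def)
  moreover have "span (A0 + B0) = span (A0 \<union> B0)"
    unfolding span_eq
  proof
    have "a + b \<in> span (A0 \<union> B0)" if "a \<in> A0" "b \<in> B0" for a b
      using that by (intro span_add; intro span_base; simp)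
    then show "A0 + B0 \<subseteq> span (A0 \<union> B0)" by (auto simp: set_plus_def)
    have "A0 \<subseteq> A0 + B0" "B0 \<subseteq> A0 + B0"
      using set_plus_intro[OF _ 0(2)] set_plus_intro[OF 0(1)] by force+
    then show "A0 \<union> B0 \<subseteq> span (A0 + B0)" by (auto intro: span_base)
  qed
  ultimately have "aff_dim (A + B) = int (dim (span (A0 \<union> B0)))"
    using aff_dim_eq_dim_subtract[of "a + b" "A + B"] a b
    by (metis dim_span hull_inc set_plus_intro)
  also have "span (A0 \<union> B0) = {x + y |x y. x \<in> span A0 \<and> y \<in> span B0}"
    unfolding span_Un by blast
  finally have "aff_dim (A + B) + int (dim (span A0 \<inter> span B0)) = int (dim A0) + int (dim B0)"
    using dim_sums_Int[of "span A0" "span B0"] by simp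
  moreover have "aff_dim A = int (dim A0)" "aff_dim B = int (dim B0)"
    unfolding A0_def B0_def using a b by (auto intro!: aff_dim_eq_dim_subtract hull_inc)
  ultimately show ?thesis by (simp add: A0_def B0_def)
qed

lemma aff_dim_set_plus_le:
  fixes A B :: "'a::euclidean_space set"
  assumes "A \<noteq> {}" "B \<noteq> {}"
  shows "aff_dim (A + B) \<le> aff_dim A + aff_dim B"
proof -
  obtain a b where "a \<in> A" "b \<in> B" using assms by blast
  then show ?thesis by (simp add: aff_dim_set_plus)
qed

lemma aff_dim_set_plus_exact_subset:
  fixes A B :: "'a::euclidean_space set"
  assumes sub: "A' \<subseteq> A" "B' \<subseteq> B" and ne: "A' \<noteq> {}" "B' \<noteq> {}"
    and exact: "aff_dim (A + B) = aff_dim A + aff_dim B"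
  shows "aff_dim (A' + B') = aff_dim A' + aff_dim B'"
proof -
  obtain a b where ab: "a \<in> A'" "b \<in> B'" using ne by blast
  let ?L = "\<lambda>c X. span ((\<lambda>x. x - c) ` X)"
  have "a \<in> A" "b \<in> B" using ab sub by blast+
  then have "dim (?L a A \<inter> ?L b B) = 0" using exact aff_dim_set_plus by fastforce
  moreover have "?L a A' \<inter> ?L b B' \<subseteq> ?L a A \<inter> ?L b B"
    using sub by (meson Int_mono image_mono span_mono)
  ultimately have "dim (?L a A' \<inter> ?L b B') = 0"
    using dim_subset by (metis le_zero_eq)
  then show ?thesis using aff_dim_set_plus[OF ab] by simp
qed

lemma aff_dim_set_sum_le:
  fixes A :: "'i \<Rightarrow> 'a::euclidean_space set"
  assumes "finite I" "\<And>i. i \<in> I \<Longrightarrow> A i \<noteq> {}"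
  shows "aff_dim (\<Sum>i\<in>I. A i) \<le> (\<Sum>i\<in>I. aff_dim (A i))"
  using assms
proof (induction I rule: finite_induct)
  case (insert i I)
  then have "aff_dim (A i + (\<Sum>i\<in>I. A i)) \<le> aff_dim (A i) + aff_dim (\<Sum>i\<in>I. A i)"
    by (intro aff_dim_set_plus_le set_sum_nonempty) auto
  with insert show ?case by simp
qed simp

lemma aff_dim_set_sum_exact_subset:
  fixes A A' :: "'i \<Rightarrow> 'a::euclidean_space set"
  assumes "finite I" "\<And>i. i \<in> I \<Longrightarrow> A' i \<subseteq> A i \<and> A' i \<noteq> {}"
    and "aff_dim (\<Sum>i\<in>I. A i) = (\<Sum>i\<in>I. aff_dim (A i))"
  shows "aff_dim (\<Sum>i\<in>I. A' i) = (\<Sum>i\<in>I. aff_dim (A' i))"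
  using assms
proof (induction I rule: finite_induct)
  case (insert i I)
  let ?Q = "\<Sum>i\<in>I. A i" and ?Q' = "\<Sum>i\<in>I. A' i"
  have ne: "A i \<noteq> {}" "\<And>j. j \<in> I \<Longrightarrow> A j \<noteq> {}" using insert.prems(1) by blast+
  have "aff_dim (A i + ?Q) \<le> aff_dim (A i) + aff_dim ?Q"
    using ne insert.hyps by (intro aff_dim_set_plus_le set_sum_nonempty)
  moreover have "aff_dim ?Q \<le> (\<Sum>i\<in>I. aff_dim (A i))"
    using ne insert.hyps by (intro aff_dim_set_sum_le)
  moreover have "aff_dim (A i + ?Q) = aff_dim (A i) + (\<Sum>i\<in>I. aff_dim (A i))"
    using insert.prems(2) insert.hyps by simp
  ultimately have exact: "aff_dim ?Q = (\<Sum>i\<in>I. aff_dim (A i))"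
      "aff_dim (A i + ?Q) = aff_dim (A i) + aff_dim ?Q" by linarith+
  have "?Q' \<subseteq> ?Q"
  proof
    fix x assume "x \<in> ?Q'"
    then obtain s where "x = (\<Sum>i\<in>I. s i)" "\<And>i. i \<in> I \<Longrightarrow> s i \<in> A' i"
      using set_sum_memE[OF insert.hyps(1)] by blast
    with insert.prems(1) insert.hyps show "x \<in> ?Q" by (auto intro!: sum_mem_set_sum)
  qed
  moreover have "?Q' \<noteq> {}" using insert.prems(1) insert.hyps by (intro set_sum_nonempty) auto
  ultimately have "aff_dim (A' i + ?Q') = aff_dim (A' i) + aff_dim ?Q'"
    using insert.prems(1)[of i] exact(2)
    by (intro aff_dim_set_plus_exact_subset[of "A' i" "A i" ?Q' ?Q]) simp_all
  with insert exact(1) show ?case by simp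
qed simp

text \<open>A proper nonempty face of the sum lies in a facet, the facet has an exact decomposition, and the
  summands of the face lie in those of the facet.\<close>

lemma aff_dim_max_face_general_position:
  fixes P :: "nat \<Rightarrow> 'a::euclidean_space set"
  assumes P: "\<And>i. i \<in> {1..r} \<Longrightarrow> polytope (P i) \<and> P i \<noteq> {}"
    and gen: "relatively_in_general_position r P"
    and proper: "max_face (\<Sum>i\<in>{1..r}. P i) c \<noteq> (\<Sum>i\<in>{1..r}. P i)"
  shows "aff_dim (max_face (\<Sum>i\<in>{1..r}. P i) c) = (\<Sum>i\<in>{1..r}. aff_dim (max_face (P i) c))"
proof -
  let ?P = "\<Sum>i\<in>{1..r}. P i"
  have cc: "compact (P i) \<and> convex (P i) \<and> P i \<noteq> {}" if "i \<in> {1..r}" for i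
    using P[OF that] by (simp add: polytope_imp_compact polytope_imp_convex)
  have poly: "polytope ?P" using P by (intro polytope_set_sum) auto
  have ne: "?P \<noteq> {}" using P by (intro set_sum_nonempty) auto
  have face: "max_face ?P c face_of ?P" "max_face ?P c \<noteq> {}"
    using max_face_face_of[OF polytope_imp_convex[OF poly]]
      max_face_nonempty[OF polytope_imp_compact[OF poly] ne] by simp_all
  obtain F where F: "F facet_of ?P" "max_face ?P c \<subseteq> F"
    using face_of_polyhedron_subset_facet[OF polytope_imp_polyhedron[OF poly] face proper] .
  obtain D where D: "face_decomposition r P F D" "aff_dim F = (\<Sum>i\<in>{1..r}. aff_dim (D i))"
    using gen F(1) by (auto simp: relatively_in_general_position_def has_exact_decomposition_def)
  have "F face_of ?P" "F \<noteq> {}" using F(1) by (auto simp: facet_of_def)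
  then obtain u where u: "F = max_face ?P u"
    using face_of_polytope_eq_max_face[OF poly] by blast
  have Du: "D i = max_face (P i) u" if i: "i \<in> {1..r}" for i
  proof (rule decomposition_unique[OF _ i])
    show "D j face_of P j \<and> D j \<noteq> {}" if "j \<in> {1..r}" for j
      using D(1) that unfolding face_decomposition_def by blast
    show "max_face ?P u = (\<Sum>j\<in>{1..r}. D j)"
      using D(1) u unfolding face_decomposition_def by simp
  qed (use cc in simp_all)
  have "aff_dim (\<Sum>i\<in>{1..r}. max_face (P i) c) = (\<Sum>i\<in>{1..r}. aff_dim (max_face (P i) c))"
  proof (rule aff_dim_set_sum_exact_subset[of _ _ D])
    show "max_face (P i) c \<subseteq> D i \<and> max_face (P i) c \<noteq> {}" if i: "i \<in> {1..r}" for i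
    proof
      show "max_face (P i) c \<subseteq> D i"
        unfolding Du[OF i]
        by (rule max_face_summand_mono[OF _ i]) (use cc F(2) u in simp_all)
      show "max_face (P i) c \<noteq> {}" using cc[OF i] max_face_nonempty by blast
    qed
    show "aff_dim (\<Sum>i\<in>{1..r}. D i) = (\<Sum>i\<in>{1..r}. aff_dim (D i))"
      using D by (simp add: face_decomposition_def)
  qed simp
  then show ?thesis by (simp add: max_face_set_sum)
qed


section \<open>Sums over proper faces\<close>

definition proper_faces :: "'a::euclidean_space set \<Rightarrow> 'a set set" where
  "proper_faces S = {F. F face_of S \<and> F \<noteq> {} \<and> F \<noteq> S}"

text \<open>The component in \<open>S\<close> of a face \<open>G\<close> of \<open>P\<close>. If the normal fan of \<open>P\<close> refines that of \<open>S\<close>, it is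
  independent of the choice of the functional selecting \<open>G\<close>.\<close>

definition face_summand :: "'a::euclidean_space set \<Rightarrow> 'a set \<Rightarrow> 'a set \<Rightarrow> 'a set" where
  "face_summand P S G = max_face S (SOME c. max_face P c = G)"

lemma face_summand_max_face:
  assumes "fan_refines P S"
  shows "face_summand P S (max_face P c) = max_face S c"
proof -
  have "max_face P (SOME c'. max_face P c' = max_face P c) = max_face P c"
    by (rule someI[of "\<lambda>c'. max_face P c' = max_face P c" c]) simp
  then show ?thesis using assms unfolding face_summand_def fan_refines_def by blast
qed

lemma finite_proper_faces: "polytope S \<Longrightarrow> finite (proper_faces S)"
  unfolding proper_faces_def by (rule finite_subset[OF _ finite_polytope_faces]) auto

lemma proper_faces_eq:
  fixes S :: "'a::euclidean_space set"
  assumes "polytope S" "S \<noteq> {}"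
  shows "proper_faces S = range (max_face S) - {S}"
  using faces_eq_max_face_image[OF assms] unfolding proper_faces_def by blast

text \<open>For full-dimensional polytopes such that the fan of \<open>P\<close> refines that of \<open>S\<close>, this makes
  \<open>face_summand P S\<close> map proper faces to proper faces, since in both polytopes the proper nonempty
  faces are those selected by nonzero functionals.\<close>

lemma max_face_eq_self_iff:
  fixes S :: "'a::euclidean_space set"
  assumes "aff_dim S = int DIM('a)"
  shows "max_face S c = S \<longleftrightarrow> c = 0"
proof
  assume eq: "max_face S c = S"
  show "c = 0"
  proof (rule ccontr)
    assume "c \<noteq> 0"
    have "S \<noteq> {}" using assms by auto
    then obtain x where "x \<in> max_face S c" using eq by blast
    then have "S = S \<inter> {y. c \<bullet> y = c \<bullet> x}" using max_face_eq_Int[of x S c] eq by simp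
    then have "S \<subseteq> {y. c \<bullet> y = c \<bullet> x}" by blast
    then have "aff_dim S \<le> aff_dim {y. c \<bullet> y = c \<bullet> x}" by (rule aff_dim_subset)
    also have "\<dots> = int DIM('a) - 1" using \<open>c \<noteq> 0\<close> by (simp add: of_nat_diff Suc_leI)
    finally show False using assms by simp
  qed
qed simp

text \<open>Grouping the proper faces of \<open>P\<close> by their component \<open>F\<close> in \<open>S\<close>, the weight \<open>g\<close> is constant on each
  group and the signs in the group add up to that of \<open>F\<close>.\<close>

lemma sum_proper_faces_fan_refines:
  fixes P S :: "'a::euclidean_space set" and g :: "'a set \<Rightarrow> real"
  assumes P: "polytope P" "aff_dim P = int DIM('a)"
    and S: "polytope S" "aff_dim S = int DIM('a)"
    and ref: "fan_refines P S"
  shows "(\<Sum>G\<in>proper_faces P. euler_sign G * g (face_summand P S G)) =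
    (\<Sum>F\<in>proper_faces S. euler_sign F * g F)"
proof -
  have ne: "P \<noteq> {}" "S \<noteq> {}" using P(2) S(2) by auto
  let ?fib = "\<lambda>F. max_face P ` normal_cone_of_face S F"
  have summand: "face_summand P S G = F" if G: "G \<in> ?fib F" for F G
  proof -
    obtain c where "G = max_face P c" "max_face S c = F"
      using G by (auto simp: normal_cone_of_face_def)
    then show ?thesis using face_summand_max_face[OF ref] by simp
  qed
  have cover: "proper_faces P = (\<Union>F\<in>proper_faces S. ?fib F)"
  proof -
    have "proper_faces P = max_face P ` (- {0})"
      unfolding proper_faces_eq[OF P(1) ne(1)] using max_face_eq_self_iff[OF P(2)] by blast
    moreover have "(\<Union>F\<in>proper_faces S. normal_cone_of_face S F) = - {0}"
      unfolding proper_faces_eq[OF S(1) ne(2)] normal_cone_of_face_def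
      using max_face_eq_self_iff[OF S(2)] by auto
    ultimately show ?thesis by (simp flip: image_UN)
  qed
  have fin: "finite (?fib F)" if "F \<in> proper_faces S" for F
  proof (rule finite_subset[OF _ finite_proper_faces[OF P(1)]])
    show "?fib F \<subseteq> proper_faces P" unfolding cover using that by blast
  qed
  have "(\<Sum>G\<in>proper_faces P. euler_sign G * g (face_summand P S G)) =
      (\<Sum>F\<in>proper_faces S. \<Sum>G\<in>?fib F. euler_sign G * g (face_summand P S G))"
    unfolding cover
  proof (rule sum.UNION_disjoint)
    show "\<forall>F\<in>proper_faces S. \<forall>F'\<in>proper_faces S. F \<noteq> F' \<longrightarrow> ?fib F \<inter> ?fib F' = {}"
      using summand by blast
  qed (use finite_proper_faces[OF S(1)] fin in auto)
  also have "\<dots> = (\<Sum>F\<in>proper_faces S. euler_sign F * g F)"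
  proof (rule sum.cong[OF refl])
    fix F assume "F \<in> proper_faces S"
    then have F: "F face_of S" "F \<noteq> {}" by (auto simp: proper_faces_def)
    have "(\<Sum>G\<in>?fib F. euler_sign G * g (face_summand P S G)) = (\<Sum>G\<in>?fib F. euler_sign G * g F)"
      using summand by (intro sum.cong refl) simp
    also have "\<dots> = euler_sign F * g F"
      using euler_sign_fan_refines[OF P(1) ne(1) S(1) ref F] by (simp flip: sum_distrib_right)
    finally show "(\<Sum>G\<in>?fib F. euler_sign G * g (face_summand P S G)) = euler_sign F * g F" .
  qed
  finally show ?thesis .
qed

lemma euler_relation_proper_faces:
  fixes S :: "'a::euclidean_space set"
  assumes "polytope S" "aff_dim S = int DIM('a)"
  shows "(\<Sum>F\<in>proper_faces S. euler_sign F) = 1 - (-1) ^ DIM('a)"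
proof -
  have ne: "S \<noteq> {}" using assms(2) by auto
  have "S face_of S" using assms(1) polytope_imp_convex face_of_refl by blast
  then have "{F. F face_of S \<and> F \<noteq> {}} = insert S (proper_faces S)"
    using ne by (auto simp: proper_faces_def)
  then have "euler_sign S + (\<Sum>F\<in>proper_faces S. euler_sign F) = 1"
    using euler_relation[OF assms(1) ne] finite_proper_faces[OF assms(1)]
    by (simp add: proper_faces_def)
  then show ?thesis using ne assms(2) by (simp add: euler_sign_def)
qed

lemma sum_f_num_eq_sum_proper_faces:
  fixes S :: "'a::euclidean_space set" and g :: "nat \<Rightarrow> real"
  assumes S: "polytope S" "aff_dim S = int DIM('a)"
  shows "(\<Sum>k<DIM('a). (-1) ^ k * g k * real (f_num k S)) =
    (\<Sum>F\<in>proper_faces S. euler_sign F * g (nat (aff_dim F)))"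
proof -
  let ?L = "\<lambda>k. {F. F face_of S \<and> aff_dim F = int k}"
  have fin: "finite (?L k)" for k
    by (rule finite_subset[OF _ finite_polytope_faces[OF S(1)]]) auto
  have cover: "proper_faces S = (\<Union>k\<in>{..<DIM('a)}. ?L k)"
  proof (intro equalityI subsetI)
    fix F assume "F \<in> proper_faces S"
    then have F: "F face_of S" "F \<noteq> {}" "F \<noteq> S" by (auto simp: proper_faces_def)
    have "aff_dim F < int DIM('a)"
      using face_of_aff_dim_lt[OF polytope_imp_convex[OF S(1)] F(1,3)] S(2) by simp
    moreover have "aff_dim F \<ge> 0" using F(2) by (metis aff_dim_negative_iff not_le)
    ultimately show "F \<in> (\<Union>k\<in>{..<DIM('a)}. ?L k)"
      using F(1) by (intro UN_I[of "nat (aff_dim F)"]) auto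
  next
    fix F assume "F \<in> (\<Union>k\<in>{..<DIM('a)}. ?L k)"
    then obtain k where "k < DIM('a)" "F face_of S" "aff_dim F = int k" by blast
    then show "F \<in> proper_faces S" using S(2) by (auto simp: proper_faces_def)
  qed
  have "(\<Sum>F\<in>proper_faces S. euler_sign F * g (nat (aff_dim F))) =
      (\<Sum>k<DIM('a). \<Sum>F\<in>?L k. euler_sign F * g (nat (aff_dim F)))"
    unfolding cover by (rule sum.UNION_disjoint) (use fin in auto)
  also have "\<dots> = (\<Sum>k<DIM('a). \<Sum>F\<in>?L k. (-1) ^ k * g k)"
  proof (intro sum.cong refl)
    fix k F assume "F \<in> ?L k"
    then have "aff_dim F = int k" by simp
    moreover from this have "F \<noteq> {}" by auto
    ultimately show "euler_sign F * g (nat (aff_dim F)) = (-1) ^ k * g k"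
      by (simp add: euler_sign_def)
  qed
  also have "\<dots> = (\<Sum>k<DIM('a). (-1) ^ k * g k * real (f_num k S))"
    by (simp add: f_num_def mult.commute)
  finally show ?thesis by simp
qed

text \<open>The sum contains a translate of \<open>P i\<close>.\<close>

lemma aff_dim_set_sum_full:
  fixes P :: "'i \<Rightarrow> 'a::euclidean_space set"
  assumes I: "finite I" "i \<in> I" and P: "\<And>j. j \<in> I \<Longrightarrow> P j \<noteq> {}"
    and full: "aff_dim (P i) = int DIM('a)"
  shows "aff_dim (\<Sum>j\<in>I. P j) = int DIM('a)"
proof (rule antisym)
  obtain x where x: "x \<in> (\<Sum>j\<in>I - {i}. P j)"
    using set_sum_nonempty[of "I - {i}" P] I P by blast
  have "(+) x ` P i \<subseteq> P i + (\<Sum>j\<in>I - {i}. P j)"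
    using x by (auto simp: add.commute[of x])
  also have "\<dots> = (\<Sum>j\<in>I. P j)" using I by (simp add: sum.remove)
  finally have "aff_dim ((+) x ` P i) \<le> aff_dim (\<Sum>j\<in>I. P j)" by (rule aff_dim_subset)
  then show "int DIM('a) \<le> aff_dim (\<Sum>j\<in>I. P j)" using full by (simp add: aff_dim_translation_eq)
qed (rule aff_dim_le_DIM)

text \<open>Exactness distributes the dimension of a face over its components; each resulting
  sum is then regrouped by the component in \<open>P i\<close>.\<close>

lemma sum_dim_proper_faces_general_position:
  fixes P :: "nat \<Rightarrow> 'a::euclidean_space set"
  assumes r: "r \<ge> 1"
    and P: "\<And>i. i \<in> {1..r} \<Longrightarrow> polytope (P i)" "\<And>i. i \<in> {1..r} \<Longrightarrow> aff_dim (P i) = int DIM('a)"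
    and gen: "relatively_in_general_position r P"
  shows "(\<Sum>F\<in>proper_faces (\<Sum>i\<in>{1..r}. P i). euler_sign F * aff_dim F) =
    (\<Sum>i\<in>{1..r}. \<Sum>F\<in>proper_faces (P i). euler_sign F * aff_dim F)"
proof -
  let ?P = "\<Sum>i\<in>{1..r}. P i"
  have ne: "P i \<noteq> {}" if "i \<in> {1..r}" for i using P(2)[OF that] by auto
  have poly: "polytope ?P" using P(1) by (intro polytope_set_sum) auto
  have full: "aff_dim ?P = int DIM('a)"
    using r ne P(2) by (intro aff_dim_set_sum_full[of _ 1]) auto
  then have neP: "?P \<noteq> {}" by auto
  have ref: "fan_refines ?P (P i)" if i: "i \<in> {1..r}" for i
    by (rule fan_refines_summand[OF _ i]) (use ne P(1) in \<open>simp_all add: polytope_imp_compact\<close>)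
  have dim: "aff_dim G = (\<Sum>i\<in>{1..r}. aff_dim (face_summand ?P (P i) G))"
    if "G \<in> proper_faces ?P" for G
  proof -
    obtain c where c: "G = max_face ?P c" "max_face ?P c \<noteq> ?P"
      using \<open>G \<in> proper_faces ?P\<close> unfolding proper_faces_eq[OF poly neP] by blast
    have "aff_dim G = (\<Sum>i\<in>{1..r}. aff_dim (max_face (P i) c))"
      unfolding c(1) using c(2) P(1) ne by (intro aff_dim_max_face_general_position gen) auto
    also have "\<dots> = (\<Sum>i\<in>{1..r}. aff_dim (face_summand ?P (P i) G))"
      unfolding c(1) using face_summand_max_face[OF ref] by (intro sum.cong refl) simp
    finally show ?thesis .
  qed
  have "(\<Sum>G\<in>proper_faces ?P. euler_sign G * aff_dim G) =
      (\<Sum>G\<in>proper_faces ?P. \<Sum>i\<in>{1..r}. euler_sign G * aff_dim (face_summand ?P (P i) G))"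
    by (intro sum.cong refl) (simp add: dim flip: sum_distrib_left)
  also have "\<dots> =
      (\<Sum>i\<in>{1..r}. \<Sum>G\<in>proper_faces ?P. euler_sign G * aff_dim (face_summand ?P (P i) G))"
    by (rule sum.swap)
  also have "\<dots> = (\<Sum>i\<in>{1..r}. \<Sum>F\<in>proper_faces (P i). euler_sign F * aff_dim F)"
    by (rule sum.cong[OF refl], rule sum_proper_faces_fan_refines[OF poly full P(1) P(2) ref])
  finally show ?thesis .
qed

theorem corollary3:
  fixes P :: "nat \<Rightarrow> 'a::euclidean_space set" and r :: nat and a :: real
  assumes "r \<ge> 1"
    and "\<And>i. i \<in> {1..r} \<Longrightarrow> polytope (P i)"
    and "\<And>i. i \<in> {1..r} \<Longrightarrow> aff_dim (P i) = int DIM('a)"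
    and "relatively_in_general_position r P"
  shows "(\<Sum>k<DIM('a). (-1) ^ k * (real k + a) * real_of_int (f_delta k r P))
           = a * (1 - real r) * (1 - (-1) ^ DIM('a))"
proof -
  let ?P = "\<Sum>i\<in>{1..r}. P i"
  let ?e = "1 - (-1::real) ^ DIM('a)"
  let ?w = "\<lambda>Q :: 'a set. \<Sum>F\<in>proper_faces Q. euler_sign F * aff_dim F"
  have weighted: "(\<Sum>k<DIM('a). (-1) ^ k * (real k + a) * real (f_num k Q)) = ?w Q + a * ?e"
    if Q: "polytope Q" "aff_dim Q = int DIM('a)" for Q :: "'a set"
  proof -
    have "(\<Sum>k<DIM('a). (-1) ^ k * (real k + a) * real (f_num k Q)) =
        (\<Sum>F\<in>proper_faces Q. euler_sign F * (real (nat (aff_dim F)) + a))"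
      by (rule sum_f_num_eq_sum_proper_faces[OF Q])
    also have "\<dots> = (\<Sum>F\<in>proper_faces Q. euler_sign F * aff_dim F + a * euler_sign F)"
    proof (intro sum.cong refl)
      fix F assume "F \<in> proper_faces Q"
      then have "aff_dim F \<ge> 0" by (metis (mono_tags) proper_faces_def mem_Collect_eq
            aff_dim_negative_iff not_le)
      then show "euler_sign F * (real (nat (aff_dim F)) + a) =
          euler_sign F * aff_dim F + a * euler_sign F"
        by (simp add: algebra_simps)
    qed
    also have "\<dots> = ?w Q + a * ?e"
      using euler_relation_proper_faces[OF Q] by (simp add: sum.distrib flip: sum_distrib_left)
    finally show ?thesis .
  qed
  have poly: "polytope ?P" using assms(2) by (intro polytope_set_sum) auto
  have full: "aff_dim ?P = int DIM('a)"
    using assms(1,3) by (intro aff_dim_set_sum_full[of _ 1]) fastforce+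
  have "(\<Sum>k<DIM('a). (-1) ^ k * (real k + a) * real_of_int (f_delta k r P)) =
      (\<Sum>k<DIM('a). (-1) ^ k * (real k + a) * real (f_num k ?P)) -
      (\<Sum>i\<in>{1..r}. \<Sum>k<DIM('a). (-1) ^ k * (real k + a) * real (f_num k (P i)))"
    by (subst sum.swap) (simp add: f_delta_def right_diff_distrib sum_subtractf sum_distrib_left)
  also have "\<dots> = (?w ?P + a * ?e) - (\<Sum>i\<in>{1..r}. ?w (P i) + a * ?e)"
    using weighted[OF poly full] weighted[OF assms(2,3)] by simp
  also have "\<dots> = a * ?e - real r * (a * ?e)"
    using sum_dim_proper_faces_general_position[OF assms] by (simp add: sum.distrib)
  also have "\<dots> = a * (1 - real r) * ?e" by (simp add: algebra_simps)
  finally show ?thesis .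
qed

end
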